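(* Let $\sqsubset$ be any recursive partial order on $\mathbb{N}$. Let $A\subseteq\mathbb{N}$ be an infinite and coinfinite set which is not in the greatest one-one degree of its many-one degree. Then there is a sequence $B_0,B_1,B_2,\ldots$ of sets, each finite-one equivalent to $A$, such that for all $i,j\in\mathbb{N}$: $B_i$ is one-one reducible to $B_j$ if and only if $i=j$ or $i\sqsubset j$. That is, every recursive partial order can be embedded into the one-one degrees inside the finite-one degree of $A$.
   Context: All sets are subsets of $\mathbb{N}=\{0,1,2,\ldots\}$, identified with their characteristic functions. A many-one reduction from $A$ to $B$ is a total recursive function $f:\mathbb{N}\to\mathbb{N}$ with $A(x)=B(f(x))$ for all $x$. It is a finite-one reduction if for each $y$ there are at most finitely many $x$ with $f(x)=y$, and a one-one reduction if for each $y$ there is at most one $x$ with $f(x)=y$. $A$ is many-one (finite-one, one-one) reducible to $B$ if such a reduction exists; $A$ and $B$ are equivalent in the respective sense if each is reducible to the other. The many-one (finite-one, one-one) degree of $A$ is the set of all $B\subseteq\mathbb{N}$ equivalent to $A$ in that sense. $A$ is in the greatest one-one degree of its many-one degree if every set in the many-one degree of $A$ is one-one reducible to $A$. A recursive partial order $\sqsubset$ is a strict (irreflexive, transitive) order relation on $\mathbb{N}$ such that for all distinct $i,j$ exactly one of the following holds and an algorithm can decide which one: $i\sqsubset j$; $j\sqsubset i$; $i,j$ are incomparable. *)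

theory Defs
  imports Main
begin

section \<open>Partial recursive functions\<close>

text \<open>
  Programs carry no arity annotation: the length of the argument list passed to a program
  determines the length passed to each of its subprograms.  On argument lists of an unsuitable
  length a program is undefined (\<^const>\<open>None\<close>).
\<close>

datatype recf =
    Zero
  | Succ
  | Proj nat
  | Comp recf "recf list"
  | PrimRec recf recf
  | Mu recf

text \<open>
  Composition is strict in all its arguments.  \<open>PrimRec f g\<close> recurses on the first argument;
  \<open>g\<close> receives the predecessor, the previous value and the parameters.  \<open>Mu f\<close> searches for the
  least zero in the first argument of \<open>f\<close> and is defined only if \<open>f\<close> is defined at all smaller
  values.
\<close>

fun recf_value :: "recf \<Rightarrow> nat list \<Rightarrow> nat option" where
  "recf_value Zero xs = Some 0"
| "recf_value Succ xs = (case xs of [x] \<Rightarrow> Some (Suc x) | _ \<Rightarrow> None)"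
| "recf_value (Proj i) xs = (if i < length xs then Some (xs ! i) else None)"
| "recf_value (Comp f gs) xs =
     Option.bind (those (map (\<lambda>g. recf_value g xs) gs)) (\<lambda>ys. recf_value f ys)"
| "recf_value (PrimRec f g) xs =
     (case xs of
        [] \<Rightarrow> None
      | n # ys \<Rightarrow>
          rec_nat (recf_value f ys) (\<lambda>m r. Option.bind r (\<lambda>y. recf_value g (m # y # ys))) n)"
| "recf_value (Mu f) xs =
     (if \<exists>n. recf_value f (n # xs) = Some 0 \<and> (\<forall>m<n. recf_value f (m # xs) \<noteq> None)
      then Some (LEAST n. recf_value f (n # xs) = Some 0)
      else None)"

definition total_recursive :: "(nat \<Rightarrow> nat) \<Rightarrow> bool" where
  "total_recursive f \<longleftrightarrow> (\<exists>p. \<forall>x. recf_value p [x] = Some (f x))"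

section \<open>Reducibilities and degrees\<close>

definition many_one_reduction :: "(nat \<Rightarrow> nat) \<Rightarrow> nat set \<Rightarrow> nat set \<Rightarrow> bool" where
  "many_one_reduction f A B \<longleftrightarrow> total_recursive f \<and> (\<forall>x. x \<in> A \<longleftrightarrow> f x \<in> B)"

definition finite_one_reduction :: "(nat \<Rightarrow> nat) \<Rightarrow> nat set \<Rightarrow> nat set \<Rightarrow> bool" where
  "finite_one_reduction f A B \<longleftrightarrow> many_one_reduction f A B \<and> (\<forall>y. finite {x. f x = y})"

definition one_one_reduction :: "(nat \<Rightarrow> nat) \<Rightarrow> nat set \<Rightarrow> nat set \<Rightarrow> bool" where
  "one_one_reduction f A B \<longleftrightarrow> many_one_reduction f A B \<and> inj f"

definition many_one_reducible :: "nat set \<Rightarrow> nat set \<Rightarrow> bool" where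
  "many_one_reducible A B \<longleftrightarrow> (\<exists>f. many_one_reduction f A B)"

definition finite_one_reducible :: "nat set \<Rightarrow> nat set \<Rightarrow> bool" where
  "finite_one_reducible A B \<longleftrightarrow> (\<exists>f. finite_one_reduction f A B)"

definition one_one_reducible :: "nat set \<Rightarrow> nat set \<Rightarrow> bool" where
  "one_one_reducible A B \<longleftrightarrow> (\<exists>f. one_one_reduction f A B)"

definition many_one_degree :: "nat set \<Rightarrow> nat set set" where
  "many_one_degree A = {B. many_one_reducible A B \<and> many_one_reducible B A}"

definition finite_one_degree :: "nat set \<Rightarrow> nat set set" where
  "finite_one_degree A = {B. finite_one_reducible A B \<and> finite_one_reducible B A}"

definition in_greatest_one_one_degree :: "nat set \<Rightarrow> bool" where
  "in_greatest_one_one_degree A \<longleftrightarrow> (\<forall>B \<in> many_one_degree A. one_one_reducible B A)"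

section \<open>Recursive partial orders\<close>

text \<open>
  That the three alternatives for distinct arguments exclude each other follows from
  irreflexivity and transitivity.  The deciding program reports the alternative by the values
  0, 1, 2 and is not constrained on equal arguments.
\<close>

definition recursive_partial_order :: "(nat \<Rightarrow> nat \<Rightarrow> bool) \<Rightarrow> bool" where
  "recursive_partial_order R \<longleftrightarrow>
     irreflp R \<and> transp R \<and>
     (\<exists>p. \<forall>i j. i \<noteq> j \<longrightarrow>
        recf_value p [i, j] = Some (if R i j then 0 else if R j i then 1 else 2))"

end

theory Submission
  imports Defs "HOL-Library.Nat_Bijection" "HOL-Library.Infinite_Set"
begin

text \<open>
  Every \<open>B\<^sub>k\<close> is a version of \<open>A\<close> in which each number \<open>z\<close> is replaced by finitely many copies.
  The copies are the numbers \<open>u = pair z m\<close> of a decidable set \<open>S\<^sub>k\<close>, which contains all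
  \<open>pair z 0\<close>, and \<open>B\<^sub>k\<close> is obtained from \<open>{u \<in> S\<^sub>k. left u \<in> A}\<close> by numbering \<open>S\<^sub>k\<close>
  recursively.  Forgetting \<open>m\<close> and choosing the copy \<open>pair z 0\<close> are finite-one reductions between
  \<open>B\<^sub>k\<close> and \<open>A\<close>, and \<open>S\<^sub>i \<subseteq> S\<^sub>j\<close> yields a one-one reduction of \<open>B\<^sub>i\<close> to \<open>B\<^sub>j\<close>.
  So it suffices to arrange \<open>S\<^sub>i \<subseteq> S\<^sub>j\<close> whenever \<open>i\<close> is below or equal to \<open>j\<close>, and to rule out
  recursive injections \<open>\<psi>\<close> of \<open>S\<^sub>i\<close> into \<open>S\<^sub>j\<close> that respect \<open>A\<close> in the remaining cases.

  This is done by the pigeonhole principle: if \<open>S\<^sub>i\<close> has more copies of \<open>z\<close> than \<open>S\<^sub>j\<close> has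
  copies of all numbers up to \<open>z\<close> together, then \<open>\<psi>\<close> sends some copy of \<open>z\<close> to a copy of a
  number \<open>y > z\<close>, and \<open>y \<in> A \<longleftrightarrow> z \<in> A\<close>.  If this happens for almost all \<open>z\<close>, then iterating
  \<open>z \<mapsto> y\<close> turns every many-one reduction to \<open>A\<close> into an injective one
  (\<open>in_greatest_one_one_degree_if_increasing\<close>), against the hypothesis on \<open>A\<close>.

  A requirement consists of a program and a pair \<open>i\<close>, \<open>j\<close>.  It has to be served at almost all
  \<open>z\<close>, but different requirements make opposite demands at the same \<open>z\<close>, and each \<open>z\<close> may
  receive only finitely many copies.  Therefore at every stage a requirement owns at most one
  number, and only the owner of \<open>z\<close> may order copies of \<open>z\<close>.  A requirement gives up \<open>z\<close> once its
  program has been seen to send a copy of \<open>z\<close> above \<open>z\<close>; other requirements can own \<open>z\<close> then.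
  The owner of each \<open>z\<close> converges, because only the requirements \<open>r \<le> z\<close> compete for it, and by
  induction on \<open>z\<close> it follows that \<open>z\<close> is copied finitely often (\<open>finite_actions\<close>).  A requirement
  with \<open>i\<close> not below or equal to \<open>j\<close> whose program does compute an injection of \<open>S\<^sub>i\<close> into \<open>S\<^sub>j\<close>
  cannot own a number forever, since it would order infinitely many copies of it.
  Hence its program raises all numbers except perhaps finitely many, such as those
  that requirements of smaller index keep forever (\<open>reduction_raises_almost_all\<close>).

  The construction is effective because evaluation of programs has a decidable
  approximation: a value is correct iff a finite derivation tree certifies it
  (\<open>universal_approximation\<close>).
\<close>

section \<open>A calculus of total recursive functions\<close>

definition pair :: "nat \<Rightarrow> nat \<Rightarrow> nat" where "pair a b = prod_encode (a, b)"
definition left :: "nat \<Rightarrow> nat" where "left z = fst (prod_decode z)"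
definition right :: "nat \<Rightarrow> nat" where "right z = snd (prod_decode z)"

lemma left_pair [simp]: "left (pair a b) = a"
  and right_pair [simp]: "right (pair a b) = b"
  and pair_left_right [simp]: "pair (left z) (right z) = z"
  by (simp_all add: pair_def left_def right_def)

lemma pair_eq_iff [simp]: "pair a b = pair c d \<longleftrightarrow> a = c \<and> b = d"
  by (simp add: pair_def)

lemma left_le: "left z \<le> z" and right_le: "right z \<le> z"
  using le_prod_encode_1[of "left z" "right z"] le_prod_encode_2[of "right z" "left z"]
  by (simp_all add: left_def right_def)

text \<open>
  All functions are handled as unary ones; several arguments are packed by \<^const>\<open>pair\<close>, and a
  bound variable is added to the context by one more pairing.  Closure properties then take the
  form of introduction rules that follow the syntax of a term.  Binary programs occur only where
  a scheme of \<^typ>\<open>recf\<close> has to be met directly.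
\<close>

definition total_recursive2 :: "(nat \<Rightarrow> nat \<Rightarrow> nat) \<Rightarrow> bool" where
  "total_recursive2 h \<longleftrightarrow> (\<exists>p. \<forall>x y. recf_value p [x, y] = Some (h x y))"

lemma total_recursive_id: "total_recursive (\<lambda>x. x)"
  unfolding total_recursive_def by (rule exI[of _ "Proj 0"]) simp

lemma total_recursive_comp:
  assumes "total_recursive f" "total_recursive g"
  shows "total_recursive (\<lambda>x. f (g x))"
proof -
  obtain p q where "\<forall>x. recf_value p [x] = Some (f x)" "\<forall>x. recf_value q [x] = Some (g x)"
    using assms unfolding total_recursive_def by blast
  then have "\<forall>x. recf_value (Comp p [q]) [x] = Some (f (g x))" by simp
  then show ?thesis unfolding total_recursive_def by blast
qed

lemma total_recursive2_comp:
  assumes "total_recursive2 h" "total_recursive f" "total_recursive g"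
  shows "total_recursive (\<lambda>x. h (f x) (g x))"
proof -
  obtain p q r where "\<forall>x y. recf_value p [x, y] = Some (h x y)"
      "\<forall>x. recf_value q [x] = Some (f x)" "\<forall>x. recf_value r [x] = Some (g x)"
    using assms unfolding total_recursive_def total_recursive2_def by blast
  then have "\<forall>x. recf_value (Comp p [q, r]) [x] = Some (h (f x) (g x))" by simp
  then show ?thesis unfolding total_recursive_def by blast
qed

lemma total_recursive_Suc: "total_recursive f \<Longrightarrow> total_recursive (\<lambda>x. Suc (f x))"
  by (rule total_recursive_comp[of Suc])
    (auto simp: total_recursive_def intro: exI[of _ Succ])

lemma total_recursive_const: "total_recursive (\<lambda>x. c)"
proof (induction c)
  case 0
  show ?case unfolding total_recursive_def by (rule exI[of _ Zero]) simp
qed (rule total_recursive_Suc)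

definition "add_prog = PrimRec (Proj 0) (Comp Succ [Proj 1])"
definition "pred_prog = PrimRec Zero (Proj 0)"
definition "diff_prog = Comp (PrimRec (Proj 0) (Comp pred_prog [Proj 1])) [Proj 1, Proj 0]"
definition "triangle_prog = PrimRec Zero (Comp add_prog [Comp Succ [Proj 0], Proj 1])"
definition "pair_prog = Comp add_prog [Comp triangle_prog [add_prog], Proj 0]"

lemma add_prog: "recf_value add_prog [x, y] = Some (x + y)"
  unfolding add_prog_def by (induction x) auto

lemma pred_prog: "recf_value pred_prog [x] = Some (x - 1)"
  unfolding pred_prog_def by (induction x) auto

lemma diff_prog: "recf_value diff_prog [x, y] = Some (x - y)"
proof -
  have "recf_value (PrimRec (Proj 0) (Comp pred_prog [Proj 1])) [y, x] = Some (x - y)"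
    by (induction y) (auto simp: pred_prog)
  then show ?thesis unfolding diff_prog_def by simp
qed

lemma triangle_prog: "recf_value triangle_prog [x] = Some (triangle x)"
  unfolding triangle_prog_def by (induction x) (auto simp: add_prog)

lemma pair_prog: "recf_value pair_prog [x, y] = Some (pair x y)"
  unfolding pair_prog_def
  by (simp add: add_prog triangle_prog pair_def prod_encode_def del: recf_value.simps(5))

lemma total_recursive_minus:
  "total_recursive f \<Longrightarrow> total_recursive g \<Longrightarrow> total_recursive (\<lambda>x. f x - g x)"
  by (rule total_recursive2_comp) (use diff_prog in \<open>auto simp: total_recursive2_def\<close>)

lemma total_recursive_triangle:
  "total_recursive f \<Longrightarrow> total_recursive (\<lambda>x. triangle (f x))"
  by (rule total_recursive_comp) (use triangle_prog in \<open>auto simp: total_recursive_def\<close>)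

lemma total_recursive_pair:
  "total_recursive f \<Longrightarrow> total_recursive g \<Longrightarrow> total_recursive (\<lambda>x. pair (f x) (g x))"
  by (rule total_recursive2_comp) (use pair_prog in \<open>auto simp: total_recursive2_def\<close>)

lemma Least_zero_total_recursive:
  assumes "total_recursive2 h" and ex: "\<And>x. \<exists>m. h m x = 0"
  shows "total_recursive (\<lambda>x. LEAST m. h m x = 0)"
proof -
  obtain p where p: "\<And>m x. recf_value p [m, x] = Some (h m x)"
    using assms(1) unfolding total_recursive2_def by blast
  have "recf_value (Mu p) [x] = Some (LEAST m. h m x = 0)" for x
    using ex[of x] by (simp add: p)
  then show ?thesis unfolding total_recursive_def by blast
qed

lemma triangle_mono: "a \<le> b \<Longrightarrow> triangle a \<le> triangle b"
  by (induction rule: dec_induct) auto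

text \<open>
  The pairing function enumerates the diagonals \<open>a + b = t\<close>, and the diagonal \<open>t\<close> starts at
  \<^term>\<open>triangle t\<close>; so the diagonal of \<open>z\<close> is the first one that ends at or after \<open>z\<close>.
\<close>

lemma left_right_by_search:
  fixes z :: nat
  defines "t \<equiv> (LEAST t. Suc z - triangle (Suc t) = 0)"
  shows "left z = z - triangle t" "right z = t - left z"
proof -
  obtain a b where z: "z = pair a b" by (metis pair_left_right)
  have "t = a + b" unfolding t_def
  proof (rule Least_equality)
    show "Suc z - triangle (Suc (a + b)) = 0"
      by (simp add: z pair_def prod_encode_def)
  next
    fix t assume "Suc z - triangle (Suc t) = 0"
    then have "triangle (a + b) < triangle (Suc t)"
      by (simp add: z pair_def prod_encode_def)
    then show "a + b \<le> t" using triangle_mono[of "Suc t" "a + b"] by linarith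
  qed
  then show "left z = z - triangle t" "right z = t - left z"
    by (simp_all add: z) (simp add: pair_def prod_encode_def)
qed

lemma total_recursive_triangle_root:
  "total_recursive (\<lambda>z. LEAST t. Suc z - triangle (Suc t) = 0)"
proof (rule Least_zero_total_recursive)
  have "recf_value (Comp diff_prog [Comp Succ [Proj 1], Comp triangle_prog [Comp Succ [Proj 0]]]) [t, z]
      = Some (Suc z - triangle (Suc t))" for t z
    using triangle_prog[of "Suc t"] by (simp add: diff_prog del: triangle_Suc)
  then show "total_recursive2 (\<lambda>t z. Suc z - triangle (Suc t))"
    unfolding total_recursive2_def by blast
  have "z \<le> triangle z" for z by (induction z) auto
  then show "\<exists>t. Suc z - triangle (Suc t) = 0" for z
    by (intro exI[of _ z]) simp
qed

lemma total_recursive_left: "total_recursive f \<Longrightarrow> total_recursive (\<lambda>x. left (f x))"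
  by (rule total_recursive_comp[of left]) (unfold left_right_by_search(1)[abs_def],
    intro total_recursive_minus total_recursive_triangle total_recursive_triangle_root total_recursive_id)

lemma total_recursive_right: "total_recursive f \<Longrightarrow> total_recursive (\<lambda>x. right (f x))"
  by (rule total_recursive_comp[of right]) (unfold left_right_by_search(2)[abs_def],
    intro total_recursive_minus total_recursive_left total_recursive_triangle_root total_recursive_id)

named_theorems recursive_intros

lemmas [recursive_intros] = total_recursive_id total_recursive_const total_recursive_Suc
  total_recursive_minus total_recursive_pair
  total_recursive_left total_recursive_right

lemma total_recursive_rec_nat [recursive_intros]:
  assumes "total_recursive n" "total_recursive f"
    and "total_recursive (\<lambda>z. g (left z) (left (right z)) (right (right z)))"
  shows "total_recursive (\<lambda>x. rec_nat (f x) (\<lambda>m r. g m r x) (n x))"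
proof -
  obtain p q where p: "\<And>x. recf_value p [x] = Some (f x)"
    and q: "\<And>z. recf_value q [z] = Some (g (left z) (left (right z)) (right (right z)))"
    using assms(2,3) unfolding total_recursive_def by blast
  let ?q = "Comp q [Comp pair_prog [Proj 0, Comp pair_prog [Proj 1, Proj 2]]]"
  have "recf_value (PrimRec p ?q) [k, x] = Some (rec_nat (f x) (\<lambda>m r. g m r x) k)" for k x
    by (induction k) (auto simp: p q pair_prog)
  then have "total_recursive2 (\<lambda>k x. rec_nat (f x) (\<lambda>m r. g m r x) k)"
    unfolding total_recursive2_def by blast
  from total_recursive2_comp[OF this assms(1) total_recursive_id] show ?thesis .
qed

lemma total_recursive_if_zero:
  assumes "total_recursive c" "total_recursive f" "total_recursive g"
  shows "total_recursive (\<lambda>x. if c x = 0 then f x else g x)"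
proof -
  have "(\<lambda>x. if c x = 0 then f x else g x) = (\<lambda>x. rec_nat (f x) (\<lambda>_ _. g x) (c x))"
  proof
    fix x show "(if c x = 0 then f x else g x) = rec_nat (f x) (\<lambda>_ _. g x) (c x)"
      by (cases "c x") simp_all
  qed
  moreover have "total_recursive (\<lambda>x. rec_nat (f x) (\<lambda>_ _. g x) (c x))"
    by (intro recursive_intros assms(1,2) total_recursive_comp[OF assms(3)])
  ultimately show ?thesis by (simp only:)
qed

text \<open>
  Truth is represented by 0, the value for which minimization searches.
\<close>

definition decidable :: "(nat \<Rightarrow> bool) \<Rightarrow> bool" where
  "decidable P \<longleftrightarrow> total_recursive (\<lambda>x. if P x then 0 else 1)"

lemma if_zero_one_eq_zero [simp]: "(if P then 0 else Suc 0) = 0 \<longleftrightarrow> P"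
  by simp

lemma decidable_comp: "decidable P \<Longrightarrow> total_recursive f \<Longrightarrow> decidable (\<lambda>x. P (f x))"
  unfolding decidable_def using total_recursive_comp by fast

lemma total_recursive_if [recursive_intros]:
  assumes "decidable P" "total_recursive f" "total_recursive g"
  shows "total_recursive (\<lambda>x. if P x then f x else g x)"
  using total_recursive_if_zero[OF assms(1)[unfolded decidable_def] assms(2,3)]
  by (simp only: One_nat_def if_zero_one_eq_zero)

lemma decidable_iff_zero: "total_recursive f \<Longrightarrow> decidable (\<lambda>x. f x = 0)"
  unfolding decidable_def by (intro total_recursive_if_zero recursive_intros)

lemma decidable_le [recursive_intros]:
  "total_recursive f \<Longrightarrow> total_recursive g \<Longrightarrow> decidable (\<lambda>x. f x \<le> g x)"
  using decidable_iff_zero[OF total_recursive_minus, of f g] by simp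

lemma decidable_less [recursive_intros]:
  "total_recursive f \<Longrightarrow> total_recursive g \<Longrightarrow> decidable (\<lambda>x. f x < g x)"
  using decidable_le[OF total_recursive_Suc, of f g] by (simp add: Suc_le_eq)

lemma decidable_const [recursive_intros]: "decidable (\<lambda>x. c)"
  unfolding decidable_def by (intro recursive_intros)

lemma decidable_not [recursive_intros]:
  assumes "decidable P"
  shows "decidable (\<lambda>x. \<not> P x)"
proof -
  have "(\<lambda>x. if \<not> P x then 0 else 1) = (\<lambda>x. if P x then 1 else (0 :: nat))" by auto
  then show ?thesis unfolding decidable_def[of "\<lambda>x. \<not> P x"]
    by (simp only:) (intro recursive_intros assms)
qed

lemma decidable_conj [recursive_intros]:
  assumes "decidable P" "decidable Q"
  shows "decidable (\<lambda>x. P x \<and> Q x)"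
proof -
  have "(\<lambda>x. if P x \<and> Q x then 0 else 1) = (\<lambda>x. if P x then if Q x then 0 else 1 else (1 :: nat))"
    by auto
  then show ?thesis unfolding decidable_def[of "\<lambda>x. P x \<and> Q x"]
    by (simp only:) (intro recursive_intros assms)
qed

lemma decidable_disj [recursive_intros]:
  "decidable P \<Longrightarrow> decidable Q \<Longrightarrow> decidable (\<lambda>x. P x \<or> Q x)"
  using decidable_not[OF decidable_conj[OF decidable_not decidable_not], of P Q] by simp

lemma decidable_imp [recursive_intros]:
  "decidable P \<Longrightarrow> decidable Q \<Longrightarrow> decidable (\<lambda>x. P x \<longrightarrow> Q x)"
  using decidable_disj[OF decidable_not, of P Q] by simp

lemma decidable_eq [recursive_intros]:
  "total_recursive f \<Longrightarrow> total_recursive g \<Longrightarrow> decidable (\<lambda>x. f x = g x)"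
  using decidable_conj[OF decidable_le decidable_le, of f g g f] by (simp add: eq_iff)

lemma decidable_finite: "finite F \<Longrightarrow> decidable (\<lambda>x. x \<in> F)"
proof (induction rule: finite_induct)
  case empty
  show ?case unfolding empty_iff by (rule decidable_const)
next
  case (insert a F)
  then show ?case unfolding insert_iff by (intro recursive_intros)
qed

lemma total_recursive_Least [recursive_intros]:
  assumes "decidable (\<lambda>z. P (left z) (right z))" and ex: "\<And>x. \<exists>m. P m x"
  shows "total_recursive (\<lambda>x. LEAST m. P m x)"
proof -
  obtain p where p: "\<And>z. recf_value p [z] = Some (if P (left z) (right z) then 0 else 1)"
    using assms(1) unfolding decidable_def total_recursive_def by blast
  have "recf_value (Comp p [pair_prog]) [m, x] = Some (if P m x then 0 else 1)" for m x
    by (simp add: pair_prog p)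
  then have "total_recursive2 (\<lambda>m x. if P m x then 0 else 1)"
    unfolding total_recursive2_def by blast
  from Least_zero_total_recursive[OF this] ex show ?thesis
    by (simp only: One_nat_def if_zero_one_eq_zero)
qed

text \<open>
  Stopping the search for a witness at the bound makes it total.
\<close>

lemma decidable_bounded_ex [recursive_intros]:
  assumes "total_recursive b" "decidable (\<lambda>z. P (left z) (right z))"
  shows "decidable (\<lambda>x. \<exists>m<b x. P m x)"
proof -
  let ?m = "\<lambda>x. LEAST m. m = b x \<or> P m x"
  have "(\<exists>m<b x. P m x) \<longleftrightarrow> ?m x < b x" for x
  proof
    assume "\<exists>m<b x. P m x"
    then obtain m where "m < b x" "P m x" by blast
    then show "?m x < b x" using Least_le[of "\<lambda>m. m = b x \<or> P m x" m] by simp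
  next
    assume "?m x < b x"
    moreover have "?m x = b x \<or> P (?m x) x" by (rule LeastI[of _ "b x"]) simp
    ultimately show "\<exists>m<b x. P m x" by (metis less_irrefl)
  qed
  moreover have "decidable (\<lambda>x. ?m x < b x)"
    by (intro recursive_intros assms total_recursive_comp[OF assms(1)]) auto
  ultimately show ?thesis by simp
qed

lemma decidable_bounded_all [recursive_intros]:
  assumes "total_recursive b" "decidable (\<lambda>z. P (left z) (right z))"
  shows "decidable (\<lambda>x. \<forall>m<b x. P m x)"
  using decidable_not[OF decidable_bounded_ex[OF assms(1) decidable_not[OF assms(2)]]] by simp

text \<open>
  The history of \<open>f\<close> at \<open>n\<close> codes the values below \<open>n\<close> as nested pairs with the most
  recent value outermost; to find the value at \<open>m\<close> one therefore needs to know \<open>n\<close>.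
\<close>

definition history :: "(nat \<Rightarrow> nat) \<Rightarrow> nat \<Rightarrow> nat" where
  "history f n = rec_nat 0 (\<lambda>m r. pair (f m) r) n"

definition lookup :: "nat \<Rightarrow> nat \<Rightarrow> nat \<Rightarrow> nat" where
  "lookup h n m = left (rec_nat h (\<lambda>_ r. right r) (n - Suc m))"

lemma lookup_history [simp]: "m < n \<Longrightarrow> lookup (history f n) n m = f m"
proof -
  have *: "rec_nat (history f (j + k)) (\<lambda>_ r. right r) k = history f j" for j k
  proof (induction k arbitrary: j)
    case (Suc k)
    show ?case using Suc[of "Suc j"] by (simp add: history_def)
  qed (simp add: history_def)
  assume "m < n"
  with *[of "Suc m" "n - Suc m"] show ?thesis by (simp add: lookup_def) (simp add: history_def)
qed

lemma total_recursive_lookup [recursive_intros]: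
  assumes "total_recursive h" "total_recursive n" "total_recursive m"
  shows "total_recursive (\<lambda>x. lookup (h x) (n x) (m x))"
  unfolding lookup_def by (intro recursive_intros assms)

text \<open>
  The history obeys a primitive recursion, and the value of \<open>f\<close> at \<open>n\<close> is the outermost entry of
  the history at \<open>Suc n\<close>.
\<close>

lemma total_recursive_course_of_values:
  assumes step: "\<And>n x. f n x = G n x (history (\<lambda>m. f m x) n)"
    and G: "total_recursive (\<lambda>z. G (left z) (left (right z)) (right (right z)))"
    and n: "total_recursive n" and x: "total_recursive x"
  shows "total_recursive (\<lambda>z. f (n z) (x z))"
proof -
  have h: "history (\<lambda>m. f m a) k = rec_nat 0 (\<lambda>m r. pair (G m a r) r) k" for k a
  proof (induction k)
    case (Suc k)
    then show ?case using step[of k a] by (simp add: history_def)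
  qed (simp add: history_def)
  have "total_recursive (\<lambda>z. rec_nat 0 (\<lambda>m r. pair (G m (right z) r) r) (left z))"
    using total_recursive_comp[OF G, of "\<lambda>z. pair (left z) (pair (right (right (right z))) (left (right z)))"]
    by (intro recursive_intros) (simp add: recursive_intros)
  then have "total_recursive (\<lambda>z. history (\<lambda>m. f m (right z)) (left z))"
    by (simp add: h)
  from total_recursive_comp[OF this, of "\<lambda>z. pair (Suc (n z)) (x z)"]
  have "total_recursive (\<lambda>z. left (history (\<lambda>m. f m (x z)) (Suc (n z))))"
    by (simp add: recursive_intros n x)
  then show ?thesis by (simp add: history_def)
qed

section \<open>A decidable approximation of all total recursive functions\<close>

subsection \<open>Derivation trees for decidable rules\<close>

text \<open>
  The tree with conclusion \<open>c\<close> and subtrees \<open>s\<close>, \<open>t\<close> is coded by \<open>Suc (pair c (pair s t))\<close>, so subtrees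
  have smaller codes.  At an axiom the subtrees are arbitrary.  Rules with a single premise are
  covered by repeating the premise.
\<close>

function is_derivation :: "(nat \<Rightarrow> bool) \<Rightarrow> (nat \<Rightarrow> nat \<Rightarrow> nat \<Rightarrow> bool) \<Rightarrow> nat \<Rightarrow> bool" where
  "is_derivation Ax Rl t =
    (if t = 0 then False
     else Ax (left (t - 1)) \<or>
       Rl (left (left (right (t - 1)) - 1)) (left (right (right (t - 1)) - 1)) (left (t - 1)) \<and>
       is_derivation Ax Rl (left (right (t - 1))) \<and> is_derivation Ax Rl (right (right (t - 1))))"
  by pat_completeness auto

lemma left_right_less: "t \<noteq> 0 \<Longrightarrow> left (right (t - 1)) < t"
  and right_right_less: "t \<noteq> 0 \<Longrightarrow> right (right (t - 1)) < t"
  using left_le[of "right (t - 1)"] right_le[of "right (t - 1)"] right_le[of "t - 1"] by linarith+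

termination
  by (relation "measure (\<lambda>(_, _, t). t)") (use left_right_less right_right_less in auto)

declare is_derivation.simps [simp del]

inductive derivable for Ax :: "nat \<Rightarrow> bool" and Rl :: "nat \<Rightarrow> nat \<Rightarrow> nat \<Rightarrow> bool" where
  axiom: "Ax c \<Longrightarrow> derivable Ax Rl c"
| rule: "derivable Ax Rl a \<Longrightarrow> derivable Ax Rl b \<Longrightarrow> Rl a b c \<Longrightarrow> derivable Ax Rl c"

lemma derivable_iff_derivation:
  "derivable Ax Rl c \<longleftrightarrow> (\<exists>t. is_derivation Ax Rl t \<and> left (t - 1) = c)"
proof
  assume "derivable Ax Rl c"
  then show "\<exists>t. is_derivation Ax Rl t \<and> left (t - 1) = c"
  proof induction
    case (axiom c)
    then show ?case
      by (intro exI[of _ "Suc (pair c 0)"]) (simp add: is_derivation.simps[of _ _ "Suc _"])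
  next
    case (rule a b c)
    then obtain s t where "is_derivation Ax Rl s" "left (s - 1) = a"
      "is_derivation Ax Rl t" "left (t - 1) = b" by blast
    with rule.hyps show ?case
      by (intro exI[of _ "Suc (pair c (pair s t))"]) (simp add: is_derivation.simps[of _ _ "Suc _"])
  qed
next
  have "derivable Ax Rl (left (t - 1))" if "is_derivation Ax Rl t" for t
    using that
  proof (induction t rule: less_induct)
    case (less t)
    have "\<not> is_derivation Ax Rl 0" by (subst is_derivation.simps) simp
    with less.prems have "t \<noteq> 0" by metis
    with less show ?case
      using is_derivation.simps[of Ax Rl t] left_right_less right_right_less
      by (metis derivable.intros)
  qed
  then show "\<exists>t. is_derivation Ax Rl t \<and> left (t - 1) = c \<Longrightarrow> derivable Ax Rl c" by blast
qed

lemma decidable_is_derivation: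
  assumes Ax: "decidable Ax"
    and Rl: "decidable (\<lambda>z. Rl (left z) (left (right z)) (right (right z)))"
  shows "decidable (is_derivation Ax Rl)"
proof -
  let ?f = "\<lambda>t (_ :: nat). if is_derivation Ax Rl t then 0 else (1 :: nat)"
  let ?G = "\<lambda>t (x :: nat) h. if t = 0 then 1
     else if Ax (left (t - 1)) \<or>
       Rl (left (left (right (t - 1)) - 1)) (left (right (right (t - 1)) - 1)) (left (t - 1)) \<and>
       lookup h t (left (right (t - 1))) = 0 \<and> lookup h t (right (right (t - 1))) = 0
     then 0 else (1 :: nat)"
  have Rl': "decidable (\<lambda>x. Rl (a x) (b x) (c x))"
    if "total_recursive a" "total_recursive b" "total_recursive c" for a b c
    using decidable_comp[OF Rl, of "\<lambda>x. pair (a x) (pair (b x) (c x))"] that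
    by (simp add: recursive_intros)
  have "total_recursive (\<lambda>z. ?f z 0)"
  proof (rule total_recursive_course_of_values[where f = ?f and G = ?G 
        and n = "\<lambda>z. z" and x = "\<lambda>_ :: nat. 0"])
    show "?f t x = ?G t x (history (\<lambda>m. ?f m x) t)" for t x
      using left_right_less[of t] right_right_less[of t]
      by (subst is_derivation.simps) simp
    show "total_recursive (\<lambda>z. ?G (left z) (left (right z)) (right (right z)))"
      by (intro recursive_intros Rl' decidable_comp[OF Ax])
  qed (intro recursive_intros)+
  then show ?thesis by (simp add: decidable_def)
qed

subsection \<open>Evaluation of programs as a system of rules\<close>

primrec code :: "recf \<Rightarrow> nat" where
  "code Zero = pair 0 0"
| "code Succ = pair 1 0"
| "code (Proj i) = pair 2 i"
| "code (Comp f gs) = pair 3 (pair (code f) (list_encode (map code gs)))"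
| "code (PrimRec f g) = pair 4 (pair (code f) (code g))"
| "code (Mu f) = pair 5 (code f)"

definition cons :: "nat \<Rightarrow> nat \<Rightarrow> nat" where "cons x l = Suc (pair x l)"

lemma cons_simps [simp]: "left (cons x l - 1) = x" "right (cons x l - 1) = l"
    "cons x l = cons y k \<longleftrightarrow> x = y \<and> l = k" "cons x l \<noteq> 0" "0 \<noteq> cons x l"
    "left (cons x l - Suc 0) = x" "right (cons x l - Suc 0) = l"
  by (simp_all add: cons_def)

declare list_encode.simps(2) [simp del]

lemma list_encode_Cons [simp]: "list_encode (x # xs) = cons x (list_encode xs)"
  by (simp add: cons_def pair_def list_encode.simps(2))

lemma list_encode_eq_0 [simp]: "list_encode xs = 0 \<longleftrightarrow> xs = []" "0 = list_encode xs \<longleftrightarrow> xs = []"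
  by (cases xs; simp)+

lemma list_encode_eq_cons [simp]:
  "list_encode xs = cons a l \<longleftrightarrow> (\<exists>ys. xs = a # ys \<and> list_encode ys = l)"
  "cons a l = list_encode xs \<longleftrightarrow> (\<exists>ys. xs = a # ys \<and> list_encode ys = l)"
  by (cases xs; auto)+

text \<open>
  Three kinds of statements are derived.  \<open>evaluates p x y\<close>: the program \<open>p\<close> has the value \<open>y\<close> on
  the argument list \<open>x\<close>.  \<open>evaluates_list gs x ys\<close>: the programs in the list \<open>gs\<close> have the values \<open>ys\<close>
  on \<open>x\<close>.  \<open>positive_below f n x\<close>: \<open>f\<close> is defined and nonzero on \<open>m # x\<close> for all \<open>m < n\<close>.
  The last two break up the unboundedly many premises of composition and minimization into
  rules with at most two premises.
\<close>

definition judgement :: "nat \<Rightarrow> nat \<Rightarrow> nat \<Rightarrow> nat \<Rightarrow> nat" where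
  "judgement k p x y = pair k (pair p (pair x y))"

definition subject :: "nat \<Rightarrow> nat" where "subject c = left (right c)"
definition inputs :: "nat \<Rightarrow> nat" where "inputs c = left (right (right c))"
definition outcome :: "nat \<Rightarrow> nat" where "outcome c = right (right (right c))"

abbreviation evaluates :: "nat \<Rightarrow> nat \<Rightarrow> nat \<Rightarrow> nat" where "evaluates \<equiv> judgement 0"
abbreviation evaluates_list :: "nat \<Rightarrow> nat \<Rightarrow> nat \<Rightarrow> nat" where "evaluates_list \<equiv> judgement 1"
abbreviation positive_below :: "nat \<Rightarrow> nat \<Rightarrow> nat \<Rightarrow> nat" where "positive_below \<equiv> judgement 2"

lemma judgement_simps [simp]:
  "judgement k p x y = judgement k' p' x' y' \<longleftrightarrow> k = k' \<and> p = p' \<and> x = x' \<and> y = y'"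
  "subject (judgement k p x y) = p" "inputs (judgement k p x y) = x" "outcome (judgement k p x y) = y"
  by (simp_all add: judgement_def subject_def inputs_def outcome_def)

inductive computes :: "nat \<Rightarrow> bool" where
  Zero: "computes (evaluates (pair 0 0) xs 0)"
| Succ: "computes (evaluates (pair 1 0) (cons x 0) (Suc x))"
| Proj_0: "computes (evaluates (pair 2 0) (cons x xs) x)"
| Proj_Suc: "computes (evaluates (pair 2 i) xs y) \<Longrightarrow> computes (evaluates (pair 2 (Suc i)) (cons x xs) y)"
| Nil: "computes (evaluates_list 0 xs 0)"
| Cons: "computes (evaluates g xs y) \<Longrightarrow> computes (evaluates_list gs xs ys) \<Longrightarrow>
    computes (evaluates_list (cons g gs) xs (cons y ys))"
| Comp: "computes (evaluates f ys y) \<Longrightarrow> computes (evaluates_list gs xs ys) \<Longrightarrow>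
    computes (evaluates (pair 3 (pair f gs)) xs y)"
| PrimRec_0: "computes (evaluates f ys y) \<Longrightarrow> computes (evaluates (pair 4 (pair f g)) (cons 0 ys) y)"
| PrimRec_Suc: "computes (evaluates (pair 4 (pair f g)) (cons n ys) r) \<Longrightarrow>
    computes (evaluates g (cons n (cons r ys)) y) \<Longrightarrow>
    computes (evaluates (pair 4 (pair f g)) (cons (Suc n) ys) y)"
| Below_0: "computes (positive_below f 0 xs)"
| Below_Suc: "computes (evaluates f (cons n xs) (Suc y)) \<Longrightarrow> computes (positive_below f n xs) \<Longrightarrow>
    computes (positive_below f (Suc n) xs)"
| Mu: "computes (evaluates f (cons n xs) 0) \<Longrightarrow> computes (positive_below f n xs) \<Longrightarrow>
    computes (evaluates (pair 5 f) xs n)"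

text \<open>
  To make it evident that the rules are decidable, the variables of each rule are expressed by
  projections of its premises and, where no premise determines a variable, of its conclusion.
\<close>

definition eval_axiom :: "nat \<Rightarrow> bool" where
  "eval_axiom c \<longleftrightarrow>
     c = evaluates (pair 0 0) (inputs c) 0 \<or>
     c = evaluates (pair 1 0) (cons (left (inputs c - 1)) 0) (Suc (left (inputs c - 1))) \<or>
     c = evaluates (pair 2 0) (cons (outcome c) (right (inputs c - 1))) (outcome c) \<or>
     c = evaluates_list 0 (inputs c) 0 \<or>
     c = positive_below (subject c) 0 (outcome c)"

definition eval_rule :: "nat \<Rightarrow> nat \<Rightarrow> nat \<Rightarrow> bool" where
  "eval_rule a b c \<longleftrightarrow>
     (let p = subject a; x = inputs a; y = outcome a; q = subject b; u = inputs b; v = outcome b in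
      a = evaluates (pair 2 (right p)) x y \<and>
        c = evaluates (pair 2 (Suc (right p))) (cons (left (inputs c - 1)) x) y \<or>
      a = evaluates p x y \<and> b = evaluates_list q u v \<and> u = x \<and>
        c = evaluates_list (cons p q) u (cons y v) \<or>
      a = evaluates p x y \<and> b = evaluates_list q u x \<and> c = evaluates (pair 3 (pair p q)) u y \<or>
      a = evaluates p x y \<and> c = evaluates (pair 4 (pair p (right (right (subject c))))) (cons 0 x) y \<or>
      a = evaluates (pair 4 (pair (left (right p)) q)) (cons (left (x - 1)) (right (x - 1))) y \<and>
        b = evaluates q (cons (left (x - 1)) (cons y (right (x - 1)))) v \<and>
        c = evaluates (pair 4 (pair (left (right p)) q)) (cons (Suc (left (x - 1))) (right (x - 1))) v \<or>
      a = evaluates q (cons u v) (Suc (y - 1)) \<and> b = positive_below q u v \<and>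
        c = positive_below q (Suc u) v \<or>
      a = evaluates q (cons u v) 0 \<and> b = positive_below q u v \<and>
        c = evaluates (pair 5 q) v u)"

lemma computes_iff_derivable: "computes c \<longleftrightarrow> derivable eval_axiom eval_rule c"
proof
  let ?d = "derivable eval_axiom eval_rule"
  assume "computes c"
  then show "?d c"
  proof induction
    case (Comp f ys y gs xs)
    from Comp.IH show ?case
      by (rule derivable.rule) (simp add: eval_rule_def Let_def)
  next
    case (Cons f ys y gs xs)
    from Cons.IH show ?case
      by (rule derivable.rule) (simp add: eval_rule_def Let_def)
  next
    case (PrimRec_Suc f g n ys r y)
    from PrimRec_Suc.IH show ?case
      by (rule derivable.rule) (simp add: eval_rule_def Let_def)
  next
    case (Below_Suc f n xs y)
    from Below_Suc.IH show ?case
      by (rule derivable.rule) (simp add: eval_rule_def Let_def)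
  next
    case (Mu f n xs)
    from Mu.IH show ?case
      by (rule derivable.rule) (simp add: eval_rule_def Let_def)
  next
    case (Proj_Suc i xs y x)
    from Proj_Suc.IH Proj_Suc.IH show ?case
      by (rule derivable.rule) (simp add: eval_rule_def Let_def)
  next
    case (PrimRec_0 f ys y g)
    from PrimRec_0.IH PrimRec_0.IH show ?case
      by (rule derivable.rule) (simp add: eval_rule_def Let_def)
  qed (rule derivable.axiom, simp add: eval_axiom_def)+
next
  assume "derivable eval_axiom eval_rule c"
  then show "computes c"
  proof induction
    case (axiom c)
    then show ?case unfolding eval_axiom_def
      by (elim disjE, metis computes.Zero, metis computes.Succ, metis computes.Proj_0,
          metis computes.Nil, metis computes.Below_0)
  next
    case (rule a b c)
    define p x y q u v where "p = subject a" "x = inputs a" "y = outcome a"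
      "q = subject b" "u = inputs b" "v = outcome b"
    note defs = this
    define h g where "h = left (inputs c - 1)" and "g = right (right (subject c))"
    from rule.hyps(3) show ?case
      unfolding eval_rule_def Let_def defs [symmetric] h_def [symmetric] g_def [symmetric]
      using rule.IH by (elim disjE conjE) (auto intro: computes.intros simp del: One_nat_def)
  qed
qed

lemma decidable_eval_axiom: "decidable eval_axiom"
  unfolding eval_axiom_def[abs_def] judgement_def inputs_def outcome_def subject_def cons_def
  by (intro recursive_intros)

lemma decidable_eval_rule: "decidable (\<lambda>z. eval_rule (left z) (left (right z)) (right (right z)))"
  unfolding eval_rule_def[abs_def] judgement_def inputs_def outcome_def subject_def cons_def Let_def
  by (intro recursive_intros)

text \<open>
  The semantics speaks only about codes of programs and of lists of programs; a statement
  about any other number is vacuously valid.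
\<close>

definition valid :: "nat \<Rightarrow> bool" where
  "valid c \<longleftrightarrow>
    (\<forall>p xs y. c = evaluates (code p) (list_encode xs) y \<longrightarrow> recf_value p xs = Some y) \<and>
    (\<forall>gs xs ys. c = evaluates_list (list_encode (map code gs)) (list_encode xs) (list_encode ys) \<longrightarrow>
       those (map (\<lambda>g. recf_value g xs) gs) = Some ys) \<and>
    (\<forall>f n xs. c = positive_below (code f) n (list_encode xs) \<longrightarrow>
       (\<forall>m<n. \<exists>y. recf_value f (m # xs) = Some (Suc y)))"

lemma ex_list_encode: "\<exists>xs. l = list_encode xs"
  by (metis list_decode_inverse)

lemma pair_eq_code [simp]:
  "pair 0 0 = code p \<longleftrightarrow> p = Zero"
  "pair (Suc 0) 0 = code p \<longleftrightarrow> p = Succ"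
  "pair 2 i = code p \<longleftrightarrow> p = Proj i"
  "pair 3 (pair a l) = code p \<longleftrightarrow> (\<exists>f gs. p = Comp f gs \<and> code f = a \<and> list_encode (map code gs) = l)"
  "pair 4 (pair a b) = code p \<longleftrightarrow> (\<exists>f g. p = PrimRec f g \<and> code f = a \<and> code g = b)"
  "pair 5 a = code p \<longleftrightarrow> (\<exists>f. p = Mu f \<and> code f = a)"
  by (cases p; auto)+

lemma computes_sound: "computes c \<Longrightarrow> valid c"
proof (induction rule: computes.induct)
  case (Proj_Suc i xs y x)
  then show ?case unfolding valid_def by (fastforce split: if_splits)
next
  case (Cons g xs y gs ys)
  then show ?case unfolding valid_def by (auto simp: Cons_eq_map_conv)
next
  case (Comp f ys y gs xs)
  obtain zs where ys: "ys = list_encode zs" using ex_list_encode by blast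
  show ?case using Comp.IH unfolding valid_def ys by auto
next
  case (PrimRec_0 f ys y g)
  then show ?case unfolding valid_def by auto
next
  case (PrimRec_Suc f g n ys r y)
  have "recf_value (PrimRec p q) (Suc n # zs) = Some y"
    if "f = code p" "g = code q" "ys = list_encode zs" for p q zs
  proof -
    have "recf_value (PrimRec p q) (n # zs) = Some r"
      using PrimRec_Suc.IH(1) that unfolding valid_def by (metis code.simps(5) list_encode_Cons)
    moreover have "recf_value q (n # r # zs) = Some y"
      using PrimRec_Suc.IH(2) that unfolding valid_def by (metis list_encode_Cons)
    ultimately show ?thesis by simp
  qed
  then show ?case unfolding valid_def by (auto simp del: recf_value.simps)
next
  case (Below_Suc f n xs y)
  then show ?case unfolding valid_def by (auto simp: less_Suc_eq)
next
  case (Mu f n xs)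
  have "recf_value (Mu p) ys = Some n"
    if "recf_value p (n # ys) = Some 0" and below: "\<forall>m<n. \<exists>y. recf_value p (m # ys) = Some (Suc y)"
    for p ys
  proof -
    have "(LEAST n. recf_value p (n # ys) = Some 0) = n"
      using that by (intro Least_equality) (auto simp: not_less[symmetric])
    moreover have "\<exists>n. recf_value p (n # ys) = Some 0 \<and> (\<forall>m<n. recf_value p (m # ys) \<noteq> None)"
      using that by (intro exI[of _ n]) auto
    ultimately show ?thesis by simp
  qed
  with Mu.IH show ?case unfolding valid_def by auto
qed (auto simp: valid_def)

lemma computes_complete:
  "recf_value p xs = Some y \<Longrightarrow> computes (evaluates (code p) (list_encode xs) y)"
proof (induction p arbitrary: xs y)
  case Zero
  then show ?case using computes.Zero by simp
next
  case Succ
  then obtain x where "xs = [x]" "y = Suc x" by (auto split: list.splits)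
  then show ?case using computes.Succ[of x] by simp
next
  case (Proj i)
  then have "i < length xs" "xs ! i = y" by (auto split: if_splits)
  then have "computes (evaluates (pair 2 i) (list_encode xs) y)"
    by (induction xs arbitrary: i)
      (auto simp: nth_Cons split: nat.splits intro: computes.intros)
  then show ?case by simp
next
  case (Comp f gs)
  from Comp.prems obtain ys where ys: "those (map (\<lambda>g. recf_value g xs) gs) = Some ys"
    and y: "recf_value f ys = Some y"
    by (auto simp: Option.bind_eq_Some_conv)
  from ys Comp.IH(2) have "computes (evaluates_list (list_encode (map code gs)) (list_encode xs) (list_encode ys))"
    by (induction gs arbitrary: ys) (auto split: option.splits intro!: computes.Nil computes.Cons simp del: One_nat_def)
  with Comp.IH(1)[OF y] show ?case by (simp add: computes.Comp)
next
  case (PrimRec f g)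
  from PrimRec.prems obtain n ys where xs: "xs = n # ys" by (cases xs) auto
  from PrimRec.prems show ?case unfolding xs
  proof (induction n arbitrary: y)
    case 0
    then show ?case using PrimRec.IH(1)[of ys y] by (simp add: computes.PrimRec_0)
  next
    case (Suc n)
    then obtain r where "recf_value (PrimRec f g) (n # ys) = Some r"
      and g: "recf_value g (n # r # ys) = Some y"
      by (auto simp: Option.bind_eq_Some_conv)
    with Suc.IH[of r] PrimRec.IH(2)[OF g] show ?case by (simp add: computes.PrimRec_Suc)
  qed
next
  case (Mu f)
  let ?n = "LEAST n. recf_value f (n # xs) = Some 0"
  from Mu.prems obtain n where n: "recf_value f (n # xs) = Some 0" "\<forall>m<n. recf_value f (m # xs) \<noteq> None"
    and y: "y = ?n" by (auto split: if_splits)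
  from n(1) have y0: "recf_value f (y # xs) = Some 0" unfolding y by (rule LeastI)
  have pos: "\<exists>v. recf_value f (m # xs) = Some (Suc v)" if "m < y" for m
  proof -
    have "recf_value f (m # xs) \<noteq> Some 0" using that not_less_Least unfolding y by blast
    moreover have "recf_value f (m # xs) \<noteq> None"
      using that n(2) Least_le[of "\<lambda>n. recf_value f (n # xs) = Some 0", OF n(1)] unfolding y by auto
    ultimately show ?thesis by (metis not0_implies_Suc option.exhaust)
  qed
  have "computes (positive_below (code f) m (list_encode xs))" if "m \<le> y" for m
    using that
  proof (induction m)
    case (Suc m)
    then obtain v where "recf_value f (m # xs) = Some (Suc v)" using pos[of m] by auto
    from Mu.IH[OF this] Suc show ?case using computes.Below_Suc by simp
  qed (rule computes.Below_0)
  with Mu.IH[OF y0] show ?case by (simp add: computes.Mu)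
qed

text \<open>
  The witness \<open>D e v w s\<close> says that a derivation with code below \<open>s\<close> certifies the value \<open>w\<close> of
  program \<open>e\<close> at \<open>v\<close>.
\<close>

lemma universal_approximation:
  obtains D :: "nat \<Rightarrow> nat \<Rightarrow> nat \<Rightarrow> nat \<Rightarrow> bool" where
    "decidable (\<lambda>z. D (left z) (left (right z)) (left (right (right z))) (right (right (right z))))"
    "\<And>e v w s t. D e v w s \<Longrightarrow> s \<le> t \<Longrightarrow> D e v w t"
    "\<And>f. total_recursive f \<Longrightarrow> \<exists>e. \<forall>v w. (\<exists>s. D e v w s) \<longleftrightarrow> w = f v"
proof
  let ?D = "\<lambda>e v w s. \<exists>t<s. is_derivation eval_axiom eval_rule t \<and>
    left (t - 1) = evaluates e (cons v 0) w"
  show "decidable (\<lambda>z. ?D (left z) (left (right z)) (left (right (right z))) (right (right (right z))))"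
    unfolding judgement_def cons_def
    by (intro recursive_intros decidable_comp[OF decidable_is_derivation]
      decidable_eval_axiom decidable_eval_rule)
  show "?D e v w s \<Longrightarrow> s \<le> t \<Longrightarrow> ?D e v w t" for e v w s t
    using less_le_trans by blast
  fix f assume "total_recursive f"
  then obtain p where p: "\<And>x. recf_value p [x] = Some (f x)" unfolding total_recursive_def by blast
  have "(\<exists>s. ?D (code p) v w s) \<longleftrightarrow> computes (evaluates (code p) (list_encode [v]) w)" for v w
    by (auto simp: computes_iff_derivable derivable_iff_derivation)
  also have "\<dots> v w \<longleftrightarrow> w = f v" for v w
    using computes_complete[of p "[v]"] computes_sound[of "evaluates (code p) (list_encode [v]) w"] p[of v]
    unfolding valid_def by auto
  finally show "\<exists>e. \<forall>v w. (\<exists>s. ?D e v w s) \<longleftrightarrow> w = f v" by blast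
qed

section \<open>The construction\<close>

text \<open>
  The copy \<open>u = pair z m\<close> doubles as the stage at which it may be ordered: \<open>b u = 0\<close> means that
  nothing is done at stage \<open>u\<close>, and \<open>b u = Suc i\<close> that \<open>u\<close> is put into all \<open>S\<^sub>k\<close> with \<open>i\<close> below or
  equal to \<open>k\<close>.  Every \<open>z\<close> thus has its turn at infinitely many stages, and the sets increase along
  the order by transitivity.
\<close>

definition copies :: "(nat \<Rightarrow> nat \<Rightarrow> bool) \<Rightarrow> (nat \<Rightarrow> nat) \<Rightarrow> nat \<Rightarrow> nat set" where
  "copies le b k = {u. right u = 0 \<or> b u \<noteq> 0 \<and> le (b u - 1) k}"

definition program :: "nat \<Rightarrow> nat" where "program r = left r"
definition source :: "nat \<Rightarrow> nat" where "source r = left (right r)"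
definition target :: "nat \<Rightarrow> nat" where "target r = right (right r)"

text \<open>
  By stage \<open>s\<close> the program of \<open>r\<close> has been seen to send a copy of \<open>z\<close> above \<open>z\<close>.
\<close>

definition raised ::
  "(nat \<Rightarrow> nat \<Rightarrow> bool) \<Rightarrow> (nat \<Rightarrow> nat \<Rightarrow> nat \<Rightarrow> nat \<Rightarrow> bool) \<Rightarrow> (nat \<Rightarrow> nat) \<Rightarrow> nat \<Rightarrow> nat \<Rightarrow> nat \<Rightarrow> bool"
where
  "raised le D b s r z \<longleftrightarrow>
     (\<exists>v<s. v \<in> copies le b (source r) \<and> left v = z \<and> (\<exists>w<s. D (program r) v w s \<and> z < left w))"

text \<open>
  The owner of \<open>z\<close> is the least requirement \<open>r \<le> z\<close> that still has to raise \<open>z\<close> (\<open>M r z\<close> says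
  that it has done so) and owns no smaller number.  A value above the argument means that there
  is no owner, hence the alternative \<open>y < r\<close>.  The bound \<open>r \<le> z\<close> limits the competition for \<open>z\<close> to
  finitely many requirements, which makes the owner converge.
\<close>

fun owner :: "(nat \<Rightarrow> nat \<Rightarrow> bool) \<Rightarrow> nat \<Rightarrow> nat" where
  "owner M z = (LEAST r. z < r \<or> \<not> M r z \<and> (\<forall>y\<in>{..<z}. owner M y \<noteq> r \<or> y < r))"

declare owner.simps [simp del]

text \<open>
  The owner of \<open>z\<close> orders a copy when its program is defined on all present copies of \<open>z\<close> and looks
  like an injection into the target.  As the owner has not raised \<open>z\<close>, all these values are copies of
  numbers up to \<open>z\<close>; in this way the number of those copies bounds the orders, and
  no counting is needed in the construction.
\<close>

definition wants_copy ::
  "(nat \<Rightarrow> nat \<Rightarrow> bool) \<Rightarrow> (nat \<Rightarrow> nat \<Rightarrow> nat \<Rightarrow> nat \<Rightarrow> bool) \<Rightarrow> (nat \<Rightarrow> nat) \<Rightarrow> nat \<Rightarrow> nat \<Rightarrow> nat \<Rightarrow> bool"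
where
  "wants_copy le D b s r z \<longleftrightarrow>
     r \<le> z \<and> \<not> le (source r) (target r) \<and>
     (\<forall>v<s. v \<in> copies le b (source r) \<and> left v = z \<longrightarrow>
        (\<exists>w<s. D (program r) v w s \<and> w \<in> copies le b (target r))) \<and>
     (\<forall>v<s. \<forall>v'<s. \<forall>w<s.
        v \<in> copies le b (source r) \<and> left v = z \<and> v' \<in> copies le b (source r) \<and> left v' = z \<and>
        D (program r) v w s \<and> D (program r) v' w s \<longrightarrow> v = v')"

definition stage ::
  "(nat \<Rightarrow> nat \<Rightarrow> bool) \<Rightarrow> (nat \<Rightarrow> nat \<Rightarrow> nat \<Rightarrow> nat \<Rightarrow> bool) \<Rightarrow> (nat \<Rightarrow> nat) \<Rightarrow> nat \<Rightarrow> nat"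
where
  "stage le D b s =
    (if wants_copy le D b s (owner (raised le D b s) (left s)) (left s)
     then Suc (source (owner (raised le D b s) (left s))) else 0)"

lemma stage_cong:
  assumes "\<And>u. u < s \<Longrightarrow> b u = b' u"
  shows "stage le D b s = stage le D b' s"
proof -
  have c: "u < s \<Longrightarrow> u \<in> copies le b k \<longleftrightarrow> u \<in> copies le b' k" for u k
    using assms[of u] by (simp add: copies_def)
  have "raised le D b s = raised le D b' s"
    unfolding raised_def[abs_def] by (intro ext) (use c in blast)
  moreover have "wants_copy le D b s = wants_copy le D b' s"
    unfolding wants_copy_def[abs_def] by (intro ext) (simp add: c cong: conj_cong imp_cong)
  ultimately show ?thesis unfolding stage_def by simp
qed

subsection \<open>The construction is effective\<close>

text \<open>
  The parameter \<open>x\<close> is meant to carry a stage together with the history of the construction.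
\<close>

lemma total_recursive_owner:
  assumes M: "decidable (\<lambda>z. M (left (right z)) (left z) (right (right z)))"
    and "total_recursive x" "total_recursive z"
  shows "total_recursive (\<lambda>t. owner (M (x t)) (z t))"
proof (rule total_recursive_course_of_values[where f = "\<lambda>z x. owner (M x) z"
      and G = "\<lambda>z x h. LEAST r. z < r \<or> \<not> M x r z \<and> (\<forall>y<z. lookup h z y \<noteq> r \<or> y < r)"])
  show "owner (M x) z = (LEAST r. z < r \<or> \<not> M x r z \<and>
      (\<forall>y<z. lookup (history (owner (M x)) z) z y \<noteq> r \<or> y < r))" for x z
    by (subst owner.simps) (simp add: Ball_def cong: imp_cong)
  have M': "decidable (\<lambda>t. M (x t) (r t) (z t))"
    if "total_recursive x" "total_recursive r" "total_recursive z" for x r z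
    using decidable_comp[OF M, of "\<lambda>t. pair (r t) (pair (x t) (z t))"] that
    by (simp add: recursive_intros)
  show "total_recursive (\<lambda>t. LEAST r. left t < r \<or>
      \<not> M (left (right t)) r (left t) \<and>
      (\<forall>y<left t. lookup (right (right t)) (left t) y \<noteq> r \<or> y < r))"
    by (intro recursive_intros M') (auto intro: exI[of _ "Suc _"])
qed (fact assms)+

text \<open>
  Stage \<open>s\<close> consults only earlier stages, so course-of-values recursion applies.
\<close>

lemma ex_total_recursive_stages:
  assumes le: "decidable (\<lambda>z. le (left z) (right z))"
    and D: "decidable (\<lambda>z. D (left z) (left (right z)) (left (right (right z))) (right (right (right z))))"
  obtains b where "total_recursive b" "\<And>s. b s = stage le D b s"
proof
  define H where "H = rec_nat 0 (\<lambda>s h. pair (stage le D (lookup h s) s) h)"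
  define b where "b s = left (H (Suc s))" for s
  have H: "history b s = H s" for s
  proof (induction s)
    case (Suc s)
    then show ?case by (simp add: history_def b_def H_def)
  qed (simp add: history_def H_def)
  have step: "b s = stage le D (lookup (history b s) s) s" for s
    unfolding H by (simp add: b_def H_def)
  then show "b s = stage le D b s" for s
    using stage_cong[of s "lookup (history b s) s" b] by simp
  have le': "decidable (\<lambda>x. le (f x) (g x))" if "total_recursive f" "total_recursive g" for f g
    using decidable_comp[OF le, of "\<lambda>x. pair (f x) (g x)"] that by (simp add: recursive_intros)
  have D': "decidable (\<lambda>x. D (e x) (v x) (w x) (s x))"
    if "total_recursive e" "total_recursive v" "total_recursive w" "total_recursive s" for e v w s
    using decidable_comp[OF D, of "\<lambda>x. pair (e x) (pair (v x) (pair (w x) (s x)))"] that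
    by (simp add: recursive_intros)
  have c: "decidable (\<lambda>x. u x \<in> copies le (lookup (h x) (n x)) (k x))"
    if "total_recursive u" "total_recursive h" "total_recursive n" "total_recursive k" for u h n k
    unfolding copies_def mem_Collect_eq by (intro recursive_intros le' that)
  have r: "decidable (\<lambda>z. raised le D (lookup (left (left (right z))) (right (left (right z))))
      (right (left (right z))) (left z) (right (right z)))"
    unfolding raised_def program_def source_def by (intro recursive_intros le' D' c)
  have "total_recursive (\<lambda>x. owner ((\<lambda>x. raised le D (lookup (left x) (right x)) (right x)) (pair (h x) (s x))) (z x))"
    if "total_recursive h" "total_recursive s" "total_recursive z" for h s z
    by (rule total_recursive_owner) (use r in \<open>simp_all add: recursive_intros that\<close>)
  then have o: "total_recursive (\<lambda>x. owner (raised le D (lookup (h x) (s x)) (s x)) (z x))"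
    if "total_recursive h" "total_recursive s" "total_recursive z" for h s z
    using that by simp
  have w: "decidable (\<lambda>x. wants_copy le D (lookup (h x) (s x)) (s x) (r x) (z x))"
    if "total_recursive h" "total_recursive s" "total_recursive r" "total_recursive z" for h s r z
    unfolding wants_copy_def program_def source_def target_def
    by (intro recursive_intros le' D' c that that[THEN total_recursive_comp])
  have "total_recursive (\<lambda>z. (\<lambda>s x. b s) z ((\<lambda>_. 0) z))"
  proof (rule total_recursive_course_of_values[where G = "\<lambda>s (x :: nat) h. stage le D (lookup h s) s"
        and f = "\<lambda>s (x :: nat). b s" and x = "\<lambda>_. 0" and n = "\<lambda>z. z"])
    show "b s = stage le D (lookup (history b s) s) s" for s by (rule step)
    show "total_recursive (\<lambda>z. stage le D (lookup (right (right z)) (left z)) (left z))"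
      unfolding stage_def source_def by (intro recursive_intros w o)
  qed (intro recursive_intros)+
  then show "total_recursive b" by simp
qed

subsection \<open>Every number is copied finitely often\<close>

locale copying =
  fixes le :: "nat \<Rightarrow> nat \<Rightarrow> bool" and D :: "nat \<Rightarrow> nat \<Rightarrow> nat \<Rightarrow> nat \<Rightarrow> bool" and b :: "nat \<Rightarrow> nat"
  assumes le_refl: "le i i"
    and D_mono: "D e v w s \<Longrightarrow> s \<le> t \<Longrightarrow> D e v w t"
    and b_stage: "b s = stage le D b s"
begin

abbreviation "S \<equiv> copies le b"
abbreviation "own s \<equiv> owner (raised le D b s)"

lemma raised_mono: "raised le D b s r z \<Longrightarrow> s \<le> t \<Longrightarrow> raised le D b t r z"
  unfolding raised_def using D_mono less_le_trans[of _ s t] by blast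

lemma owner_satisfies:
  assumes "own s z \<le> z"
  shows "\<not> raised le D b s (own s z) z" "\<And>y. y < z \<Longrightarrow> own s y \<noteq> own s z \<or> y < own s z"
proof -
  let ?P = "\<lambda>r. z < r \<or> \<not> raised le D b s r z \<and> (\<forall>y\<in>{..<z}. own s y \<noteq> r \<or> y < r)"
  have "?P (LEAST r. ?P r)" by (rule LeastI[of ?P "Suc z"]) simp
  moreover have "own s z = (LEAST r. ?P r)" by (rule owner.simps)
  ultimately have "?P (own s z)" by (rule back_subst[where P = ?P, OF _ sym])
  with assms show "\<not> raised le D b s (own s z) z" "\<And>y. y < z \<Longrightarrow> own s y \<noteq> own s z \<or> y < own s z"
    by auto
qed

lemma owner_le:
  assumes "\<not> raised le D b s r z" "\<And>y. y < z \<Longrightarrow> own s y \<noteq> r \<or> y < r"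
  shows "own s z \<le> r"
  unfolding owner.simps[of _ z] using assms by (intro Least_le) auto

lemma raised_converges: "\<forall>\<^sub>F s in sequentially. raised le D b s r z \<longleftrightarrow> (\<exists>t. raised le D b t r z)"
  unfolding eventually_sequentially using raised_mono by blast

definition final_owner :: "nat \<Rightarrow> nat" where
  "final_owner z = (SOME c. \<forall>\<^sub>F s in sequentially. own s z = c)"

text \<open>
  Induction on \<open>z\<close>: once the owners of the smaller numbers are final and each of the finitely many
  \<open>r \<le> z\<close> has raised \<open>z\<close> if it ever does, the condition that defines the owner no longer changes.
\<close>

lemma eventually_final_owner: "\<forall>\<^sub>F s in sequentially. own s z = final_owner z"
proof (induction z rule: less_induct)
  case (less z)
  let ?m = "\<lambda>r. \<exists>t. raised le D b t r z"
  let ?c = "LEAST r. z < r \<or> \<not> ?m r \<and> (\<forall>y\<in>{..<z}. final_owner y \<noteq> r \<or> y < r)"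
  have "\<forall>\<^sub>F s in sequentially. \<forall>y\<in>{..<z}. own s y = final_owner y"
    using less by (simp add: eventually_ball_finite)
  moreover have "\<forall>\<^sub>F s in sequentially. \<forall>r\<in>{..z}. raised le D b s r z \<longleftrightarrow> ?m r"
    using raised_converges by (simp add: eventually_ball_finite)
  ultimately have "\<forall>\<^sub>F s in sequentially. own s z = ?c"
  proof eventually_elim
    case (elim s)
    have "(z < r \<or> \<not> raised le D b s r z \<and> (\<forall>y\<in>{..<z}. own s y \<noteq> r \<or> y < r)) \<longleftrightarrow>
        (z < r \<or> \<not> ?m r \<and> (\<forall>y\<in>{..<z}. final_owner y \<noteq> r \<or> y < r))" for r
    proof (cases "z < r")
      case False
      then have "raised le D b s r z \<longleftrightarrow> ?m r" using elim(2) by simp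
      moreover have "(\<forall>y\<in>{..<z}. own s y \<noteq> r \<or> y < r) \<longleftrightarrow> (\<forall>y\<in>{..<z}. final_owner y \<noteq> r \<or> y < r)"
        using elim(1) by simp
      ultimately show ?thesis by (simp only:)
    qed simp
    then show ?case unfolding owner.simps[of _ z] by (intro arg_cong[where f = Least] ext)
  qed
  then show ?case unfolding final_owner_def[of z] by (rule someI)
qed

lemma action:
  assumes "b u \<noteq> 0"
  shows "wants_copy le D b u (own u (left u)) (left u)" "b u = Suc (source (own u (left u)))"
  using assms b_stage[of u] by (auto simp: stage_def split: if_splits)

text \<open>
  Suppose that infinitely many copies of \<open>z\<close> are ordered.  From some stage \<open>s0\<close> on they are all ordered
  by the final owner \<open>r\<close>, so the source of \<open>r\<close> has infinitely many copies of \<open>z\<close>, whereas the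
  target receives none of those, because it is not above the source.  By the induction hypothesis
  the target then has only finitely many copies of numbers up to \<open>z\<close>.  But each order of \<open>r\<close> certifies
  that its program maps the present copies of \<open>z\<close> injectively into these.
\<close>

lemma finite_actions: "finite {u. left u = z \<and> b u \<noteq> 0}"
proof (induction z rule: less_induct)
  case (less z)
  define X where "X = {u. left u = z \<and> b u \<noteq> 0}"
  define r where "r = final_owner z"
  obtain s0 where s0: "\<And>s. s \<ge> s0 \<Longrightarrow> own s z = r"
    using eventually_final_owner[of z] unfolding eventually_sequentially r_def by blast
  define V where "V = {v \<in> S (source r). left v = z}"
  define W where "W = {w \<in> S (target r). left w \<le> z}"
  have "finite X"
  proof (rule ccontr)
    assume inf: "infinite X"
    have late: "\<exists>u\<in>X. n \<le> u" for n
      using inf unfolding infinite_nat_iff_unbounded_le by blast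
    have X: "wants_copy le D b u r z" "b u = Suc (source r)" "\<not> raised le D b u r z"
      if "u \<in> X" "s0 \<le> u" for u
    proof -
      have "own u z = r" "left u = z" "b u \<noteq> 0" using that s0 by (auto simp: X_def)
      then show *: "wants_copy le D b u r z" "b u = Suc (source r)" using action[of u] by auto
      then have "own u z \<le> z" using \<open>own u z = r\<close> by (simp add: wants_copy_def)
      from owner_satisfies(1)[OF this] show "\<not> raised le D b u r z" using \<open>own u z = r\<close> by simp
    qed
    have nle: "\<not> le (source r) (target r)" using late[of s0] X(1) by (auto simp: wants_copy_def)
    have "X - {..<s0} \<subseteq> V"
    proof
      fix u assume u: "u \<in> X - {..<s0}"
      then have "b u = Suc (source r)" using X(2)[of u] by auto
      with u show "u \<in> V" by (simp add: V_def X_def copies_def le_refl)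
    qed
    then have "infinite V" using inf by (meson Diff_infinite_finite finite_lessThan infinite_super)
    have "W \<subseteq> (\<lambda>y. pair y 0) ` {..z} \<union> (\<Union>y<z. {u. left u = y \<and> b u \<noteq> 0}) \<union> {..<s0}"
    proof
      fix w assume w: "w \<in> W"
      show "w \<in> (\<lambda>y. pair y 0) ` {..z} \<union> (\<Union>y<z. {u. left u = y \<and> b u \<noteq> 0}) \<union> {..<s0}"
      proof (cases "right w = 0")
        case True
        then have "w = pair (left w) 0" by (metis pair_left_right)
        with w show ?thesis by (auto simp: W_def)
      next
        case False
        with w have b: "b w \<noteq> 0" "le (b w - 1) (target r)" by (auto simp: W_def copies_def)
        have "w < s0" if "left w = z"
        proof (rule ccontr)
          assume "\<not> w < s0"
          with that b(1) have "b w = Suc (source r)" by (intro X(2)) (auto simp: X_def)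
          with b(2) nle show False by simp
        qed
        with b w show ?thesis by (auto simp: W_def)
      qed
    qed
    moreover have "finite ((\<lambda>y. pair y 0) ` {..z} \<union> (\<Union>y<z. {u. left u = y \<and> b u \<noteq> 0}) \<union> {..<s0})"
      using less by auto
    ultimately have "finite W" by (rule finite_subset)
    have "\<exists>w s. D (program r) v w s \<and> w \<in> W" if "v \<in> V" for v
    proof -
      obtain u where u: "u \<in> X" "max s0 (Suc v) \<le> u" using late by blast
      then have "v < u" "wants_copy le D b u r z" using X(1)[of u] by simp_all
      with that obtain w where w: "w < u" "D (program r) v w u" "w \<in> S (target r)"
        unfolding wants_copy_def V_def by blast
      with X(3)[of u] u that have "left w \<le> z"
        by (force simp: raised_def V_def not_le[symmetric])
      with w show ?thesis by (auto simp: W_def)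
    qed
    then obtain g t where g: "\<And>v. v \<in> V \<Longrightarrow> D (program r) v (g v) (t v)" "\<And>v. v \<in> V \<Longrightarrow> g v \<in> W"
      by metis
    have "inj_on g V"
    proof (rule inj_onI)
      fix v v' assume v: "v \<in> V" "v' \<in> V" "g v = g v'"
      obtain u where u: "u \<in> X" "s0 + Suc v + Suc v' + t v + t v' + Suc (g v) \<le> u" using late by blast
      have "D (program r) v (g v) u" "D (program r) v' (g v) u"
        using D_mono[OF g(1)[OF v(1)], of u] D_mono[OF g(1)[OF v(2)], of u] u v(3) by auto
      moreover have "v < u" "v' < u" "g v < u" "wants_copy le D b u r z" using u X(1)[of u] by simp_all
      ultimately show "v = v'" using v(1,2) unfolding wants_copy_def V_def by blast
    qed
    then show False
      using \<open>infinite V\<close> \<open>finite W\<close> g(2) by (meson finite_subset image_subsetI inj_on_finite)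
  qed
  then show ?case by (simp add: X_def)
qed

lemma finite_copies: "finite {u \<in> S k. left u = z}"
proof (rule finite_subset)
  show "{u \<in> S k. left u = z} \<subseteq> insert (pair z 0) {u. left u = z \<and> b u \<noteq> 0}"
    by (auto simp: copies_def) (metis pair_left_right)
qed (unfold finite_insert, rule finite_actions)

subsection \<open>A reduction must raise almost every number\<close>

text \<open>
  Distinct numbers have distinct final owners, as long as these are genuine.
\<close>

lemma finite_final_owner_le: "finite {z. final_owner z \<le> r \<and> final_owner z \<le> z}"
proof (rule inj_on_finite)
  show "inj_on final_owner {z. final_owner z \<le> r \<and> final_owner z \<le> z}"
  proof (rule linorder_inj_onI')
    fix y z assume *: "y \<in> {z. final_owner z \<le> r \<and> final_owner z \<le> z}"
      "z \<in> {z. final_owner z \<le> r \<and> final_owner z \<le> z}" "y < z"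
    have "\<forall>\<^sub>F s in sequentially. own s y = final_owner y \<and> own s z = final_owner z"
      by (intro eventually_conj eventually_final_owner)
    then obtain s where "own s y = final_owner y" "own s z = final_owner z"
      using eventually_happens'[OF sequentially_bot] by blast
    with owner_satisfies(2)[of s z y] * show "final_owner y \<noteq> final_owner z" by auto
  qed
qed auto

text \<open>
  Let \<open>r\<close> be a requirement for \<open>\<psi>\<close>, and let \<open>z \<ge> r\<close> be none of the finitely many numbers
  finally owned by a requirement up to \<open>r\<close>.  If \<open>r\<close> never raises \<open>z\<close>, it is prevented from owning \<open>z\<close>
  only by owning a smaller number \<open>y\<close> forever.  Then \<open>r\<close> never raises \<open>y\<close> either, and since \<open>\<psi>\<close>
  is an injection, eventually every turn of \<open>y\<close> is used for a new copy, which contradicts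
  \<open>finite_actions\<close>.
\<close>

theorem reduction_raises_almost_all:
  assumes nle: "\<not> le i j"
    and e: "\<And>v w. (\<exists>s. D e v w s) \<longleftrightarrow> w = \<psi> v"
    and inj: "inj_on \<psi> (S i)" and into: "\<And>v. v \<in> S i \<Longrightarrow> \<psi> v \<in> S j"
  shows "\<exists>n. \<forall>z\<ge>n. \<exists>v\<in>S i. left v = z \<and> z < left (\<psi> v)"
proof -
  define r where "r = pair e (pair i j)"
  have r [simp]: "program r = e" "source r = i" "target r = j"
    by (simp_all add: r_def program_def source_def target_def)
  have D: "w = \<psi> v" if "D e v w s" for v w s using e that by blast
  obtain n where n: "\<And>z. final_owner z \<le> r \<Longrightarrow> final_owner z \<le> z \<Longrightarrow> z < n"
    using finite_final_owner_le[of r] by (auto simp: finite_nat_set_iff_bounded)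
  have "\<exists>s. raised le D b s r z" if z: "n + r \<le> z" for z
  proof (rule ccontr)
    assume never: "\<nexists>s. raised le D b s r z"
    have "\<forall>\<^sub>F s in sequentially. \<forall>y\<in>{..z}. own s y = final_owner y"
      by (intro eventually_ball_finite ballI eventually_final_owner) simp
    then obtain s0 where s0: "\<And>s y. s \<ge> s0 \<Longrightarrow> y \<le> z \<Longrightarrow> own s y = final_owner y"
      unfolding eventually_sequentially by auto
    have "\<not> own s0 z \<le> r" using n[of z] z s0[of s0 z] by auto
    with owner_le[of s0 r z] never obtain y where y: "y < z" "own s0 y = r" "r \<le> y"
      by (meson not_le)
    have own: "own s y = r" if "s \<ge> s0" for s using s0[of s y] s0[of s0 y] that y by simp
    have not_raised: "\<not> raised le D b s r y" for s
      using owner_satisfies(1)[of "max s s0" y] own[of "max s s0"] y raised_mono[of s r y "max s s0"] by auto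
    define V where "V = {v \<in> S i. left v = y}"
    have "finite V" unfolding V_def by (rule finite_copies)
    have "\<exists>t. D e v (\<psi> v) t" for v using e by blast
    then obtain t where t: "\<And>v. D e v (\<psi> v) (t v)" by metis
    \<comment> \<open>From stage \<open>s1\<close> on, all values of \<open>\<psi>\<close> at the finitely many copies of \<open>y\<close> are visible.\<close>
    obtain s1 where s1: "\<And>v. v \<in> V \<Longrightarrow> t v + Suc (\<psi> v) \<le> s1"
      using finite_imageI[OF \<open>finite V\<close>, of "\<lambda>v. t v + Suc (\<psi> v)"]
      by (auto simp: finite_nat_set_iff_bounded_le)
    have act: "b u \<noteq> 0" if u: "left u = y" "s0 + s1 \<le> u" for u
    proof -
      have "wants_copy le D b u r y" unfolding wants_copy_def r
      proof (intro conjI allI impI)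
        fix v assume "v < u" "v \<in> S i \<and> left v = y"
        then have "v \<in> V" by (simp add: V_def)
        with D_mono[OF t[of v], of u] s1[of v] u into \<open>v \<in> S i \<and> left v = y\<close>
        show "\<exists>w<u. D e v w u \<and> w \<in> S j" by (intro exI[of _ "\<psi> v"]) auto
      next
        fix v v' w
        assume "v \<in> S i \<and> left v = y \<and> v' \<in> S i \<and> left v' = y \<and> D e v w u \<and> D e v' w u"
        then show "v = v'" using D inj by (metis inj_onD)
      qed (use nle y in auto)
      then show ?thesis using b_stage[of u] own[of u] u by (simp add: stage_def)
    qed
    have "range (\<lambda>m. pair y (s0 + s1 + m)) \<subseteq> {u. left u = y \<and> b u \<noteq> 0}"
    proof (rule image_subsetI)
      fix m
      have "s0 + s1 \<le> pair y (s0 + s1 + m)" using right_le[of "pair y (s0 + s1 + m)"] by simp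
      then show "pair y (s0 + s1 + m) \<in> {u. left u = y \<and> b u \<noteq> 0}" using act by simp
    qed
    moreover have "infinite (range (\<lambda>m. pair y (s0 + s1 + m)))"
      by (rule range_inj_infinite) (simp add: inj_def)
    ultimately show False using finite_actions[of y] finite_subset by blast
  qed
  then have "\<exists>v\<in>S i. left v = z \<and> z < left (\<psi> v)" if "n + r \<le> z" for z
    using that D unfolding raised_def r by metis
  then show ?thesis by blast
qed

end

section \<open>Reductions\<close>

text \<open>
  Iterating \<open>up\<close> yields arbitrarily large numbers that \<open>A\<close> does not distinguish from a given one;
  so a many-one reduction to \<open>A\<close> can be made strictly increasing by moving each value above
  the preceding one.
\<close>

lemma in_greatest_one_one_degree_if_increasing:
  assumes rec: "total_recursive up" and less: "\<And>z. z < up z"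
    and same: "\<And>z. up z \<in> A \<longleftrightarrow> z \<in> A"
  shows "in_greatest_one_one_degree A"
  unfolding in_greatest_one_one_degree_def
proof
  fix B assume "B \<in> many_one_degree A"
  then obtain f where f: "total_recursive f" "\<And>x. x \<in> B \<longleftrightarrow> f x \<in> A"
    unfolding many_one_degree_def many_one_reducible_def many_one_reduction_def by blast
  define it where "it x k = rec_nat x (\<lambda>_ r. up r) k" for x k
  have it: "it x k \<in> A \<longleftrightarrow> x \<in> A" "k \<le> it x k" for x k
  proof (induction k)
    case (Suc k)
    { case 1 from Suc show ?case by (simp add: it_def same) }
    { case 2 from Suc less[of "it x k"] show ?case by (simp add: it_def) }
  qed (simp_all add: it_def)
  define F where "F n = rec_nat (f 0) (\<lambda>m r. it (f (Suc m)) (Suc r)) n" for n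
  have "F n < F (Suc n)" for n
    using it(2)[of "Suc (F n)" "f (Suc n)"] by (simp add: F_def)
  then have "strict_mono F" by (simp add: strict_mono_Suc_iff)
  moreover have "x \<in> B \<longleftrightarrow> F x \<in> A" for x
    by (cases x) (simp_all add: F_def it f)
  moreover have "total_recursive F"
    unfolding F_def[abs_def] it_def
    by (intro recursive_intros total_recursive_comp[OF f(1)] total_recursive_comp[OF rec])
  ultimately show "one_one_reducible B A"
    unfolding one_one_reducible_def one_one_reduction_def many_one_reduction_def
    using strict_mono_imp_inj_on by blast
qed

text \<open>
  The enumeration in increasing order is used.  The inverse searches for the first entry that is not
  smaller, rather than equal, so that the search succeeds outside \<open>S\<close> too.
\<close>

lemma recursive_enumeration:
  assumes dec: "decidable (\<lambda>x. x \<in> S)" and inf: "infinite S"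
  obtains p q where "total_recursive p" "total_recursive q" "range p = S" "\<And>n. q (p n) = n"
proof
  let ?p = "enumerate S" and ?q = "\<lambda>u. LEAST n. u \<le> enumerate S n"
  have "enumerate S n = rec_nat (LEAST s. s \<in> S) (\<lambda>_ r. LEAST s. s \<in> S \<and> r < s) n" for n
    by (induction n) (simp_all add: enumerate_0 enumerate_Suc''[OF inf])
  moreover have "total_recursive (\<lambda>n. rec_nat (LEAST s. s \<in> S) (\<lambda>_ r. LEAST s. s \<in> S \<and> r < s) n)"
    using inf unfolding infinite_nat_iff_unbounded
    by (intro recursive_intros decidable_comp[OF dec]) blast
  ultimately show p: "total_recursive ?p" by presburger
  show "total_recursive ?q"
    using le_enumerate[OF inf] by (intro recursive_intros total_recursive_comp[OF p]) blast
  show "range ?p = S" by (rule range_enumerate[OF inf])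
  show "?q (?p n) = n" for n
    by (intro Least_equality) (simp_all add: enumerate_mono_le_iff[OF inf])
qed

text \<open>
  On equal arguments the deciding program may diverge.  It is therefore run with the second argument
  replaced by \<open>Suc i\<close> if both are \<open>i\<close>, and the result is disregarded in this case.
\<close>

lemma decidable_order:
  assumes "recursive_partial_order R"
  shows "decidable (\<lambda>z. left z = right z \<or> R (left z) (right z))"
proof -
  obtain p where p: "\<And>i j. i \<noteq> j \<Longrightarrow>
      recf_value p [i, j] = Some (if R i j then 0 else if R j i then 1 else 2)"
    using assms unfolding recursive_partial_order_def by blast
  define d where "d i j = (if R i j then 0 else if R j i then 1 else 2 :: nat)" for i j
  have "total_recursive (\<lambda>z. if left z = right z then Suc (left z) else right z)"
    by (intro recursive_intros)
  then obtain q where q: "\<And>z. recf_value q [z] = Some (if left z = right z then Suc (left z) else right z)"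
    unfolding total_recursive_def by blast
  obtain l where l: "\<And>z. recf_value l [z] = Some (left z)"
    using total_recursive_left[OF total_recursive_id] unfolding total_recursive_def by blast
  have "recf_value (Comp p [l, q]) [z] = Some (d (left z) (if left z = right z then Suc (left z) else right z))" for z
    by (simp add: l q p d_def)
  then have "total_recursive (\<lambda>z. d (left z) (if left z = right z then Suc (left z) else right z))"
    unfolding total_recursive_def by blast
  then have "decidable (\<lambda>z. left z = right z \<or>
      d (left z) (if left z = right z then Suc (left z) else right z) = 0)"
    by (intro recursive_intros)
  moreover have "d i (if i = j then Suc i else j) = 0 \<longleftrightarrow> R i j" if "i \<noteq> j" for i j
    using that by (simp add: d_def)
  ultimately show ?thesis by (simp cong: disj_cong)
qed

theorem theorem8:
  fixes R :: "nat \<Rightarrow> nat \<Rightarrow> bool" and A :: "nat set"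
  assumes "recursive_partial_order R"
    and "infinite A" and "infinite (- A)"
    and "\<not> in_greatest_one_one_degree A"
  shows "\<exists>B :: nat \<Rightarrow> nat set.
           (\<forall>i. B i \<in> finite_one_degree A) \<and>
           (\<forall>i j. one_one_reducible (B i) (B j) \<longleftrightarrow> i = j \<or> R i j)"
proof -
  define le where "le i j \<longleftrightarrow> i = j \<or> R i j" for i j
  have le: "decidable (\<lambda>z. le (left z) (right z))"
    unfolding le_def by (rule decidable_order[OF assms(1)])
  have "transp R" using assms(1) by (simp add: recursive_partial_order_def)
  then have le_trans: "le i j \<Longrightarrow> le j k \<Longrightarrow> le i k" for i j k
    unfolding le_def by (metis transpD)
  obtain D where D: "decidable (\<lambda>z. D (left z) (left (right z)) (left (right (right z))) (right (right (right z))))"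
    "\<And>e v w s t. D e v w s \<Longrightarrow> s \<le> t \<Longrightarrow> D e v w t"
    and universal: "\<And>f. total_recursive f \<Longrightarrow> \<exists>e. \<forall>v w. (\<exists>s. D e v w s) \<longleftrightarrow> w = f v"
    by (rule universal_approximation) blast
  obtain b where b: "total_recursive b" "\<And>s. b s = stage le D b s"
    using ex_total_recursive_stages[of le D] le D(1) by blast
  interpret copying le D b
    by unfold_locales (use D(2) b(2) in \<open>auto simp: le_def\<close>)
  have S_base: "pair x 0 \<in> S k" for x k by (simp add: copies_def)
  have S_inf: "infinite (S k)" for k
  proof (rule infinite_super)
    show "range (\<lambda>x. pair x 0) \<subseteq> S k" using S_base by blast
    show "infinite (range (\<lambda>x. pair x 0))" by (rule range_inj_infinite) (simp add: inj_def)
  qed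
  have S_mono: "S i \<subseteq> S j" if "le i j" for i j
    using that le_trans by (auto simp: copies_def)
  have S_dec: "decidable (\<lambda>x. x \<in> S k)" for k
    unfolding copies_def mem_Collect_eq
    using decidable_comp[OF le, of "\<lambda>u. pair (b u - 1) k"] b(1)
    by (intro recursive_intros) (simp_all add: recursive_intros)
  have "\<exists>p q. total_recursive p \<and> total_recursive q \<and> range p = S k \<and> (\<forall>n. q (p n) = n)" for k
    using recursive_enumeration[OF S_dec S_inf] by metis
  then obtain p q where rec: "\<And>k. total_recursive (p k)" "\<And>k. total_recursive (q k)"
    and range_p: "\<And>k. range (p k) = S k" and qp [simp]: "\<And>k n. q k (p k n) = n"
    by metis
  have pq: "p k (q k u) = u" if "u \<in> S k" for k u
    using that range_p[of k] by (metis imageE qp)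
  have inj_p: "inj (p k)" for k by (metis injI qp)
  have p_S: "p k n \<in> S k" for k n using range_p by blast
  define B where "B k = {n. left (p k n) \<in> A}" for k
  have "B k \<in> finite_one_degree A" for k
  proof -
    have "finite {n. left (p k n) = y}" for y
    proof (rule finite_imageD)
      show "finite (p k ` {n. left (p k n) = y})"
        by (rule finite_subset[OF _ finite_copies[of k y]]) (use p_S in auto)
    qed (use inj_p inj_on_subset in blast)
    then have "finite_one_reduction (\<lambda>n. left (p k n)) (B k) A"
      unfolding finite_one_reduction_def many_one_reduction_def
      by (auto simp: B_def intro!: recursive_intros rec(1))
    moreover have "finite_one_reduction (\<lambda>x. q k (pair x 0)) A (B k)"
    proof -
      have "inj (\<lambda>x. q k (pair x 0))"
        by (rule injI) (metis S_base pair_eq_iff pq)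
      then have "finite {x. q k (pair x 0) = y}" for y
        using finite_vimageI[of "{y}"] by (simp add: vimage_def)
      then show ?thesis
        unfolding finite_one_reduction_def many_one_reduction_def
        by (auto simp: B_def pq S_base intro!: recursive_intros total_recursive_comp[OF rec(2)])
    qed
    ultimately show ?thesis
      unfolding finite_one_degree_def finite_one_reducible_def by blast
  qed
  moreover have "one_one_reducible (B i) (B j)" if "le i j" for i j
  proof -
    have p_j: "p j (q j (p i n)) = p i n" for n using pq p_S S_mono[OF that] by blast
    then have "inj (\<lambda>n. q j (p i n))" by (metis injI qp)
    moreover have "total_recursive (\<lambda>n. q j (p i n))" by (rule total_recursive_comp[OF rec(2) rec(1)])
    ultimately show ?thesis
      unfolding one_one_reducible_def one_one_reduction_def many_one_reduction_def
      by (intro exI[of _ "\<lambda>n. q j (p i n)"]) (simp add: B_def p_j)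
  qed
  moreover have False if nle: "\<not> le i j" and reducible: "one_one_reducible (B i) (B j)" for i j
  proof -
    obtain f where f: "total_recursive f" "inj f" and f_B: "\<And>x. x \<in> B i \<longleftrightarrow> f x \<in> B j"
      using reducible unfolding one_one_reducible_def one_one_reduction_def many_one_reduction_def by blast
    \<comment> \<open>Carried over to the sets of copies, the reduction is an injection of \<open>S i\<close> into \<open>S j\<close>.\<close>
    define \<psi> where "\<psi> v = p j (f (q i v))" for v
    have \<psi>: "total_recursive \<psi>" unfolding \<psi>_def[abs_def]
      by (intro total_recursive_comp[OF rec(1)] total_recursive_comp[OF f(1)] rec(2))
    have "inj_on \<psi> (S i)"
      unfolding \<psi>_def by (rule inj_onI) (metis f(2) injD pq qp)
    moreover obtain e where "\<And>v w. (\<exists>s. D e v w s) \<longleftrightarrow> w = \<psi> v" using universal[OF \<psi>] by blast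
    ultimately obtain n where n: "\<And>z. n \<le> z \<Longrightarrow> \<exists>v\<in>S i. left v = z \<and> z < left (\<psi> v)"
      using reduction_raises_almost_all[OF nle, of e \<psi>] p_S unfolding \<psi>_def by blast
    have \<psi>_A: "left (\<psi> v) \<in> A \<longleftrightarrow> left v \<in> A" if "v \<in> S i" for v
      using f_B[of "q i v"] that by (simp add: B_def \<psi>_def pq)
    obtain a a' where a: "a \<in> A" "n \<le> a" "a' \<notin> A" "n \<le> a'"
      using assms(2,3) unfolding infinite_nat_iff_unbounded_le by blast
    define v where "v z = (LEAST v. z < n \<or> v \<in> S i \<and> left v = z \<and> z < left (\<psi> v))" for z
    have v: "v z \<in> S i" "left (v z) = z" "z < left (\<psi> (v z))" if "n \<le> z" for z
    proof -
      have "\<exists>v. z < n \<or> v \<in> S i \<and> left v = z \<and> z < left (\<psi> v)" using n[OF that] by blast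
      from LeastI_ex[OF this] that show "v z \<in> S i" "left (v z) = z" "z < left (\<psi> (v z))"
        unfolding v_def[symmetric] by auto
    qed
    have v_rec: "total_recursive v" unfolding v_def[abs_def]
      by (intro recursive_intros decidable_comp[OF S_dec] total_recursive_comp[OF \<psi>]) (use n not_less in blast)
    \<comment> \<open>Below \<open>n\<close>, where \<open>\<psi>\<close> may fail to raise numbers, the finitely many values are chosen by hand;
      this is possible because \<open>A\<close> and its complement have elements beyond \<open>n\<close>.\<close>
    let ?up = "\<lambda>z. if z < n then if z \<in> {z. z < n \<and> z \<in> A} then a else a' else left (\<psi> (v z))"
    have "in_greatest_one_one_degree A"
    proof (rule in_greatest_one_one_degree_if_increasing)
      show "total_recursive ?up"
        by (intro recursive_intros decidable_finite total_recursive_comp[OF \<psi>] v_rec) simp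
      show "z < ?up z" for z using a v by auto
      show "?up z \<in> A \<longleftrightarrow> z \<in> A" for z using a v[of z] \<psi>_A[of "v z"] by auto
    qed
    with assms(4) show False by blast
  qed
  ultimately show ?thesis unfolding le_def by blast
qed

end
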